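(* Let $d\ge 3$ and let $R_1,\dots,R_d\subset\mathbb{R}^d$ be the coordinate $(d-1)$-planes, so that $R_i$ consists of the points whose $i$th coordinate is zero. Let $I=[-1,1]$, let $\mathrm{Aff}\subset L_2(I^d)$ be the set of (restrictions to $I^d$ of) affine functions on $\mathbb{R}^d$, and let $\mathrm{SAff}_{R_i}(\mathbb{R}^d)\subset L_2(I^d)$ be the set of functions in $L_2(I^d)$ that are affine on each plane parallel to $R_i$. Then there is a constant $C\ge 1$ depending only on $d$ such that for any $g\in L_2(I^d)$, $$C^{-1}\sum_{i=1}^d \min_{\lambda\in \mathrm{SAff}_{R_i}(\mathbb{R}^d)}\|g-\lambda\|_2\;\le\;\min_{\lambda\in\mathrm{Aff}}\|g-\lambda\|_2\;\le\; C\sum_{i=1}^d \min_{\lambda\in \mathrm{SAff}_{R_i}(\mathbb{R}^d)}\|g-\lambda\|_2 .$$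
   Context: $\|\cdot\|_2$ is the norm of $L_2(I^d)$ with respect to Lebesgue measure. A measurable function is affine on each plane parallel to $R_i$ if its restriction to (the intersection of the cube $I^d$ with) every translate of $R_i$ agrees with an affine function of the remaining $d-1$ variables; membership in $L_2(I^d)$ is understood up to almost-everywhere equality. *)

theory Defs
  imports "HOL-Analysis.Analysis"
begin

definition cube :: "(real ^ 'n::finite) set" where
  "cube = cbox (\<chi> i. -1) (\<chi> i. 1)"

text \<open>An element of \<open>L\<^sub>2(I\<^sup>d)\<close> is represented by a function on the whole space whose values off the
  cube are irrelevant. Instead of passing to a quotient, the sets of functions below are closed
  under almost-everywhere equality on the cube.\<close>

definition L2_cube :: "(real ^ 'n::finite \<Rightarrow> real) set" where
  "L2_cube = {f. f \<in> borel_measurable (lebesgue_on cube) \<and>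
                 integrable (lebesgue_on cube) (\<lambda>x. (f x)\<^sup>2)}"

definition L2_norm :: "(real ^ 'n::finite \<Rightarrow> real) \<Rightarrow> real" where
  "L2_norm f = sqrt (integral\<^sup>L (lebesgue_on cube) (\<lambda>x. (f x)\<^sup>2))"

definition coord_plane :: "'n::finite \<Rightarrow> (real ^ 'n) set" where
  "coord_plane i = {x. x $ i = 0}"

definition Aff :: "(real ^ 'n::finite \<Rightarrow> real) set" where
  "Aff = {f \<in> L2_cube. \<exists>L c. linear L \<and> (AE x in lebesgue_on cube. f x = L x + c)}"

definition affine_on_planes :: "'n::finite \<Rightarrow> (real ^ 'n \<Rightarrow> real) \<Rightarrow> bool" where
  "affine_on_planes i h \<longleftrightarrow>
     (\<forall>v. \<exists>a b. \<forall>x \<in> cube \<inter> (+) v ` coord_plane i.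
        h x = b + (\<Sum>j \<in> UNIV - {i}. a j * x $ j))"

text \<open>The coefficients in \<^const>\<open>affine_on_planes\<close> may depend arbitrarily on the plane; measurability
  of \<open>h\<close> below follows from that of \<open>f\<close> because Lebesgue measure is complete.\<close>

definition SAff :: "'n::finite \<Rightarrow> (real ^ 'n \<Rightarrow> real) set" where
  "SAff i = {f \<in> L2_cube. \<exists>h. affine_on_planes i h \<and> (AE x in lebesgue_on cube. f x = h x)}"

text \<open>\<open>l\<close> attains the minimum of \<open>\<parallel>g - l\<parallel>\<^sub>2\<close> over \<open>l \<in> S\<close>.\<close>

definition nearest :: "(real ^ 'n::finite \<Rightarrow> real) set \<Rightarrow> (real ^ 'n \<Rightarrow> real) \<Rightarrow>
    (real ^ 'n \<Rightarrow> real) \<Rightarrow> bool" where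
  "nearest S g l \<longleftrightarrow> is_arg_min (\<lambda>l. L2_norm (\<lambda>x. g x - l x)) (\<lambda>l. l \<in> S) l"

end

theory Submission
  imports Defs "HOL-Probability.Infinite_Product_Measure"
begin

text \<open>The left inequality is immediate: an affine function is affine on every plane, so each of the \<open>d\<close>
summands is at most the distance to the affine functions.

For the right inequality let \<open>P\<^sub>i\<close> be the orthogonal projection onto the functions that are affine on
the planes parallel to \<open>R\<^sub>i\<close>. The coordinate functions are independent under the normalised measure on
the cube, so \<open>P\<^sub>i\<close> is explicit: on the slice of height \<open>t\<close> in direction \<open>i\<close>, the coefficients of
\<open>P\<^sub>i g\<close> are multiples of the integrals of \<open>g\<close> against \<open>1\<close> and \<open>x\<^sub>j\<close> for \<open>j \<noteq> i\<close>. These formulas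
also show that the minima are attained.

The key point is that for distinct directions \<open>a\<close>, \<open>b\<close>, \<open>c\<close> the function \<open>P\<^sub>c (P\<^sub>b (P\<^sub>a g))\<close> is affine.
Indeed, \<open>P\<^sub>a g\<close> is affine in all variables except \<open>x\<^sub>a\<close>, with coefficients depending arbitrarily on
\<open>x\<^sub>a\<close>. Applying \<open>P\<^sub>b\<close> averages over \<open>x\<^sub>a\<close> and leaves an affine function plus a multiple of
\<open>x\<^sub>a x\<^sub>b\<close> (\<open>slice_proj_slice_form\<close>). Applying \<open>P\<^sub>c\<close> removes the multiple of \<open>x\<^sub>a x\<^sub>b\<close>
(\<open>slice_proj_thrice_affine\<close>). Three directions exist because \<open>d \<ge> 3\<close>. Since \<open>P\<^sub>i\<close> gives
nearest points (\<open>slice_proj_minimal\<close>), the distance of this affine function to \<open>g\<close> is at most a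
constant times \<open>\<parallel>g - P\<^sub>a g\<parallel> + \<parallel>g - P\<^sub>b g\<parallel> + \<parallel>g - P\<^sub>c g\<parallel>\<close> (\<open>affine_distance_le\<close>).\<close>

section \<open>The uniform distribution on the cube and its slices\<close>

text \<open>Normalised to mass one, Lebesgue measure on the cube is a power of one probability measure on the
line. On functions \<^term>\<open>z :: 'n \<Rightarrow> real\<close>, moving to the slice of height \<open>t\<close> in direction \<open>i\<close>
is the update \<^term>\<open>z(i := t)\<close>, so that no product of spaces of different dimension appears: a slice is
parametrised by the whole cube, with the coordinate \<open>z i\<close> as an idle variable.\<close>

definition unif :: "real measure" where
  "unif = uniform_measure lborel {-1..1}"

abbreviation prod_unif :: "('n::finite \<Rightarrow> real) measure" where
  "prod_unif \<equiv> PiM UNIV (\<lambda>_. unif)"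

lemma sets_unif [simp, measurable_cong]: "sets unif = sets borel"
  by (simp add: unif_def)

lemma space_unif [simp]: "space unif = UNIV"
  by (simp add: unif_def)

lemma space_prod_unif [simp]: "space prod_unif = UNIV"
  by (simp add: space_PiM)

lemma prob_space_unif: "prob_space unif"
  unfolding unif_def by (rule prob_space_uniform_measure) auto

interpretation unif: prob_space unif
  by (rule prob_space_unif)

interpretation prod_unif: prob_space prod_unif
  by (rule prob_space_PiM) (rule prob_space_unif)

interpretation unif_pair: pair_sigma_finite unif prod_unif ..

lemma measurable_coord [measurable]: "(\<lambda>z. z i) \<in> borel_measurable prod_unif"
  by (rule measurable_compose[OF measurable_component_singleton[of i]]) auto

lemma unif_density: "unif = density lborel (\<lambda>t. ennreal (indicator {-1..1} t / 2))"
  unfolding unif_def uniform_measure_def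
  by (intro density_cong) (auto simp: indicator_def divide_ennreal[symmetric])

lemma integral_unif:
  fixes f :: "real \<Rightarrow> real"
  assumes [measurable]: "f \<in> borel_measurable borel"
  shows "integral\<^sup>L unif f = (LINT t:{-1..1}|lborel. f t) / 2"
proof -
  have "integral\<^sup>L unif f = integral\<^sup>L lborel (\<lambda>t. (indicator {-1..1} t / 2) *\<^sub>R f t)"
    unfolding unif_density by (rule integral_density) auto
  then show ?thesis
    by (simp add: set_lebesgue_integral_def)
qed

lemma AE_unif_bounded: "AE t in unif. t \<in> {-1..1}"
  unfolding unif_def by (rule AE_uniform_measureI) auto

lemma AE_unif_abs_le_1: "AE t in unif. \<bar>t\<bar> \<le> 1"
  using AE_unif_bounded by eventually_elim (auto simp: abs_le_iff)

lemma AE_prod_unif_bounded: "AE z in prod_unif. \<forall>i. z i \<in> {-1..1}"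
proof -
  have "AE z in prod_unif. z i \<in> {-1..1}" for i :: "'n::finite"
    by (rule AE_PiM_component[where P = "\<lambda>t. t \<in> {-1..1}"]) (use AE_unif_bounded prob_space_unif in auto)
  then show ?thesis by (subst AE_all_countable) blast
qed

lemma unif_mean: "integral\<^sup>L unif (\<lambda>t. t) = 0"
proof -
  have "((\<lambda>t::real. t) has_integral (1^2/2 - (-1)^2/2)) {-1..1}"
    by (rule fundamental_theorem_of_calculus)
       (auto intro!: derivative_eq_intros simp: has_real_derivative_iff_has_vector_derivative[symmetric])
  moreover have "set_integrable lborel {-1..1} (\<lambda>t::real. t)"
    by (rule borel_integrable_atLeastAtMost') (auto intro: continuous_intros)
  ultimately show ?thesis
    by (subst integral_unif) (auto simp: set_borel_integral_eq_integral integral_unique)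
qed

lemma unif_second_moment: "integral\<^sup>L unif (\<lambda>t. t * t) = 1/3"
proof -
  have "((\<lambda>t::real. t * t) has_integral (1^3/3 - (-1)^3/3)) {-1..1}"
    by (rule fundamental_theorem_of_calculus)
       (auto intro!: derivative_eq_intros simp: power2_eq_square has_real_derivative_iff_has_vector_derivative[symmetric])
  moreover have "set_integrable lborel {-1..1} (\<lambda>t::real. t * t)"
    by (rule borel_integrable_atLeastAtMost') (auto intro: continuous_intros)
  ultimately show ?thesis
    by (subst integral_unif) (auto simp: set_borel_integral_eq_integral integral_unique)
qed

text \<open>Replacing a coordinate of a random point by an independent copy does not change its law. This is
the form in which Fubini's theorem is used throughout.\<close>

lemma distr_fun_upd:
  "distr (unif \<Otimes>\<^sub>M prod_unif) prod_unif (\<lambda>(t, z). z(i := t)) = prod_unif"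
  using distr_pair_PiM_eq_PiM[of UNIV "\<lambda>_. unif" i] by (simp add: prob_space_unif)

lemma measurable_replace_coord [measurable]:
  "(\<lambda>(t, z). z(i := t)) \<in> unif \<Otimes>\<^sub>M prod_unif \<rightarrow>\<^sub>M prod_unif"
  unfolding split_beta' by (rule measurable_fun_upd[where J = UNIV]) auto

lemma
  fixes F :: "('n::finite \<Rightarrow> real) \<Rightarrow> real"
  assumes F: "integrable prod_unif F"
  shows AE_integrable_slice: "AE t in unif. integrable prod_unif (\<lambda>z. F (z(i := t)))"
    and integrable_slice_integral: "integrable unif (\<lambda>t. integral\<^sup>L prod_unif (\<lambda>z. F (z(i := t))))"
    and integral_slices:
      "integral\<^sup>L prod_unif F = integral\<^sup>L unif (\<lambda>t. integral\<^sup>L prod_unif (\<lambda>z. F (z(i := t))))"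
proof -
  have [measurable]: "F \<in> borel_measurable prod_unif"
    using F by simp
  have *: "integrable (unif \<Otimes>\<^sub>M prod_unif) (\<lambda>(t, z). F (z(i := t)))"
    using F integrable_distr_eq[OF measurable_replace_coord[of i], of F, unfolded distr_fun_upd]
    by (simp add: split_beta')
  show "AE t in unif. integrable prod_unif (\<lambda>z. F (z(i := t)))"
    using unif_pair.AE_integrable_fst[OF *] by simp
  show "integrable unif (\<lambda>t. integral\<^sup>L prod_unif (\<lambda>z. F (z(i := t))))"
    using unif_pair.integrable_fst[OF *] by simp
  have "integral\<^sup>L prod_unif F = integral\<^sup>L (unif \<Otimes>\<^sub>M prod_unif) (\<lambda>(t, z). F (z(i := t)))"
    using integral_distr[OF measurable_replace_coord[of i], of F, unfolded distr_fun_upd]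
    by (simp add: split_beta')
  with unif_pair.integral_fst[OF *] show
    "integral\<^sup>L prod_unif F = integral\<^sup>L unif (\<lambda>t. integral\<^sup>L prod_unif (\<lambda>z. F (z(i := t))))"
    by simp
qed

lemma AE_slices:
  assumes "AE z in prod_unif. P z"
  shows "AE t in unif. AE z in prod_unif. P (z(i := t))"
proof -
  have "AE x in unif \<Otimes>\<^sub>M prod_unif. P ((\<lambda>(t, z). z(i := t)) x)"
    by (rule AE_distrD[OF measurable_replace_coord]) (unfold distr_fun_upd, rule assms)
  from unif_pair.AE_pair[OF this] show ?thesis by simp
qed

section \<open>Square integrable functions and affine functions on the cube\<close>

definition sq_int :: "'a measure \<Rightarrow> ('a \<Rightarrow> real) \<Rightarrow> bool" where
  "sq_int M f \<longleftrightarrow> f \<in> borel_measurable M \<and> integrable M (\<lambda>x. (f x)\<^sup>2)"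

lemma sq_int_measurable: "sq_int M f \<Longrightarrow> f \<in> borel_measurable M"
  by (simp add: sq_int_def)

lemma sq_int_mult_integrable:
  assumes "sq_int M f" "sq_int M g"
  shows "integrable M (\<lambda>x. f x * g x)"
proof (rule Bochner_Integration.integrable_bound)
  show "integrable M (\<lambda>x. (f x)\<^sup>2 + (g x)\<^sup>2)"
    using assms by (auto simp: sq_int_def)
  show "(\<lambda>x. f x * g x) \<in> borel_measurable M"
    using assms by (auto simp: sq_int_def)
  have "\<bar>a * b\<bar> \<le> a\<^sup>2 + b\<^sup>2" for a b :: real
  proof -
    have "2 * \<bar>a * b\<bar> \<le> a\<^sup>2 + b\<^sup>2"
      using sum_squares_bound[of "\<bar>a\<bar>" "\<bar>b\<bar>"] by (simp add: abs_mult)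
    then show ?thesis by linarith
  qed
  then show "AE x in M. norm (f x * g x) \<le> norm ((f x)\<^sup>2 + (g x)\<^sup>2)"
    by auto
qed

lemma sq_int_add:
  assumes "sq_int M f" "sq_int M g"
  shows "sq_int M (\<lambda>x. f x + g x)"
  using assms sq_int_mult_integrable[OF assms]
  by (auto simp: sq_int_def power2_sum mult.assoc)

lemma sq_int_cmult: "sq_int M f \<Longrightarrow> sq_int M (\<lambda>x. c * f x)"
  by (auto simp: sq_int_def power_mult_distrib)

lemma sq_int_diff:
  assumes "sq_int M f" "sq_int M g"
  shows "sq_int M (\<lambda>x. f x - g x)"
  using sq_int_add[OF assms(1) sq_int_cmult[OF assms(2), of "-1"]] by simp

lemma sq_int_sum: "(\<And>i. i \<in> I \<Longrightarrow> sq_int M (f i)) \<Longrightarrow> sq_int M (\<lambda>x. \<Sum>i\<in>I. f i x)"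
  by (induction I rule: infinite_finite_induct) (auto simp: sq_int_add, auto simp: sq_int_def)

lemma sq_int_mult_bounded:
  assumes f: "sq_int M f" and g: "g \<in> borel_measurable M" "AE x in M. \<bar>g x\<bar> \<le> 1"
  shows "sq_int M (\<lambda>x. f x * g x)"
  unfolding sq_int_def
proof
  show "(\<lambda>x. f x * g x) \<in> borel_measurable M"
    using f g by (auto simp: sq_int_def)
  show "integrable M (\<lambda>x. (f x * g x)\<^sup>2)"
  proof (rule Bochner_Integration.integrable_bound)
    show "integrable M (\<lambda>x. (f x)\<^sup>2)" using f by (simp add: sq_int_def)
    show "(\<lambda>x. (f x * g x)\<^sup>2) \<in> borel_measurable M" using f g by (auto simp: sq_int_def)
    show "AE x in M. norm ((f x * g x)\<^sup>2) \<le> norm ((f x)\<^sup>2)"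
      using g(2) by eventually_elim (auto simp: power_mult_distrib abs_square_le_1 intro!: mult_left_le)
  qed
qed

lemma (in prob_space) sq_int_const: "sq_int M (\<lambda>_. c)"
  by (simp add: sq_int_def)

lemma (in prob_space) sq_int_integrable: "sq_int M f \<Longrightarrow> integrable M f"
  using sq_int_mult_integrable[OF _ sq_int_const[of 1]] by simp

text \<open>The variance is nonnegative.\<close>

lemma (in prob_space) expectation_squared_le:
  assumes f: "sq_int M f"
  shows "(expectation f)\<^sup>2 \<le> expectation (\<lambda>x. (f x)\<^sup>2)"
proof -
  have "0 \<le> expectation (\<lambda>x. (f x - expectation f)\<^sup>2)"
    by simp
  also have "\<dots> = expectation (\<lambda>x. (f x)\<^sup>2) - (expectation f)\<^sup>2"
    using f sq_int_integrable[OF f] by (intro variance_eq) (auto simp: sq_int_def)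
  finally show ?thesis by simp
qed

text \<open>A substitute for the triangle inequality that avoids square roots; it costs only constants.\<close>

lemma integral_square_add_le:
  assumes "sq_int M f" "sq_int M g"
  shows "(\<integral>x. (f x + g x)\<^sup>2 \<partial>M) \<le> 2 * (\<integral>x. (f x)\<^sup>2 \<partial>M) + 2 * (\<integral>x. (g x)\<^sup>2 \<partial>M)"
proof -
  have "(\<integral>x. (f x + g x)\<^sup>2 \<partial>M) \<le> (\<integral>x. 2 * (f x)\<^sup>2 + 2 * (g x)\<^sup>2 \<partial>M)"
  proof (rule integral_mono)
    show "integrable M (\<lambda>x. (f x + g x)\<^sup>2)" "integrable M (\<lambda>x. 2 * (f x)\<^sup>2 + 2 * (g x)\<^sup>2)"
      using assms sq_int_add[OF assms] by (auto simp: sq_int_def)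
    show "(f x + g x)\<^sup>2 \<le> 2 * (f x)\<^sup>2 + 2 * (g x)\<^sup>2" for x
      using sum_squares_bound[of "f x" "g x"] by (simp add: power2_sum)
  qed
  also have "\<dots> = 2 * (\<integral>x. (f x)\<^sup>2 \<partial>M) + 2 * (\<integral>x. (g x)\<^sup>2 \<partial>M)"
    using assms by (simp add: sq_int_def)
  finally show ?thesis .
qed

text \<open>By Pythagoras, the squared distance from \<open>g\<close> to \<open>f\<close> is the squared distance from \<open>g\<close> to \<open>p\<close>
plus the squared norm of \<open>p - f\<close>. All minimality statements below rest on this criterion.\<close>

lemma pythagoras_le:
  assumes "sq_int M g" "sq_int M p" "sq_int M f"
    and orth: "(\<integral>x. (g x - p x) * (p x - f x) \<partial>M) = 0"
  shows "(\<integral>x. (g x - p x)\<^sup>2 \<partial>M) \<le> (\<integral>x. (g x - f x)\<^sup>2 \<partial>M)"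
proof -
  note d = sq_int_diff[OF assms(1,2)] sq_int_diff[OF assms(2,3)]
  have i: "integrable M (\<lambda>x. (g x - p x)\<^sup>2)" "integrable M (\<lambda>x. (p x - f x)\<^sup>2)"
    "integrable M (\<lambda>x. (g x - p x) * (p x - f x))"
    using d sq_int_mult_integrable[OF d] by (auto simp: sq_int_def)
  have "(\<integral>x. (g x - f x)\<^sup>2 \<partial>M) = (\<integral>x. (g x - p x)\<^sup>2 + 2 * ((g x - p x) * (p x - f x)) + (p x - f x)\<^sup>2 \<partial>M)"
    by (rule Bochner_Integration.integral_cong) (auto simp: power2_eq_square algebra_simps)
  also have "\<dots> = (\<integral>x. (g x - p x)\<^sup>2 \<partial>M) + (\<integral>x. (p x - f x)\<^sup>2 \<partial>M)"
    using i orth by simp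
  finally show ?thesis by simp
qed

lemma distr_coord: "distr prod_unif unif (\<lambda>z. z i) = unif"
  by (rule distr_PiM_component) (auto intro: prob_space_unif)

lemma borel_measurable_unif: "borel_measurable unif = borel_measurable borel"
  by (rule measurable_cong_sets) auto

lemma
  fixes f :: "real \<Rightarrow> real"
  assumes "f \<in> borel_measurable borel"
  shows integrable_coord_iff: "integrable prod_unif (\<lambda>z. f (z i)) \<longleftrightarrow> integrable unif f"
    and integral_coord: "integral\<^sup>L prod_unif (\<lambda>z. f (z i)) = integral\<^sup>L unif f"
proof -
  have c: "(\<lambda>z. z i) \<in> prod_unif \<rightarrow>\<^sub>M unif"
    by (rule measurable_component_singleton) simp
  have f: "f \<in> borel_measurable unif"
    using assms by (simp only: borel_measurable_unif)
  show "integrable prod_unif (\<lambda>z. f (z i)) \<longleftrightarrow> integrable unif f"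
    using integrable_distr_eq[OF c f] by (simp only: distr_coord)
  show "integral\<^sup>L prod_unif (\<lambda>z. f (z i)) = integral\<^sup>L unif f"
    using integral_distr[OF c f] by (simp only: distr_coord)
qed

lemma integral_coord_eq_0 [simp]: "integral\<^sup>L prod_unif (\<lambda>z. z j) = 0"
  using integral_coord[of "\<lambda>t. t" j] by (simp add: unif_mean)

lemma sq_int_of_coord:
  assumes "sq_int unif f"
  shows "sq_int prod_unif (\<lambda>z. f (z i))"
proof -
  have f: "f \<in> borel_measurable borel"
    using assms by (simp only: sq_int_def borel_measurable_unif)
  then have "(\<lambda>t. (f t)\<^sup>2) \<in> borel_measurable borel"
    by measurable
  from integrable_coord_iff[OF this, of i] show ?thesis
    using assms measurable_compose[OF measurable_coord f, of i] by (simp add: sq_int_def)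
qed

lemma AE_coord_bounded: "AE z in prod_unif. \<bar>z i\<bar> \<le> 1"
  using AE_prod_unif_bounded by eventually_elim (auto simp: abs_le_iff minus_le_iff)

lemma sq_int_mult_coord: "sq_int prod_unif f \<Longrightarrow> sq_int prod_unif (\<lambda>z. f z * z j)"
  by (rule sq_int_mult_bounded[OF _ measurable_coord AE_coord_bounded])

lemma sq_int_coord: "sq_int prod_unif (\<lambda>z. z j)"
  using sq_int_mult_coord[OF prod_unif.sq_int_const[of 1]] by simp

lemma sq_int_affine: "sq_int prod_unif (\<lambda>z. b + (\<Sum>j\<in>J. a j * z j))"
  by (intro sq_int_add sq_int_sum sq_int_cmult sq_int_coord prod_unif.sq_int_const)

lemma integral_coord_mult_coord:
  "integral\<^sup>L prod_unif (\<lambda>z. z j * z k) = (if j = k then 1/3 else 0)"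
proof (cases "j = k")
  case True
  then show ?thesis
    using integral_coord[of "\<lambda>t. t * t" k] by (simp add: unif_second_moment)
next
  case False
  have "integral\<^sup>L prod_unif (\<lambda>z. z j * z k) = integral\<^sup>L unif (\<lambda>t. integral\<^sup>L prod_unif (\<lambda>z. t * z k))"
    using False integral_slices[OF sq_int_mult_integrable[OF sq_int_coord[of j] sq_int_coord[of k]], of j]
    by simp
  also have "\<dots> = 0"
    by simp
  finally show ?thesis using False by simp
qed

lemma integral_mult_affine:
  assumes F: "sq_int prod_unif F"
  shows "integral\<^sup>L prod_unif (\<lambda>z. F z * (b + (\<Sum>j\<in>J. a j * z j))) =
    b * integral\<^sup>L prod_unif F + (\<Sum>j\<in>J. a j * integral\<^sup>L prod_unif (\<lambda>z. F z * z j))"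
proof -
  have "integral\<^sup>L prod_unif (\<lambda>z. F z * (b + (\<Sum>j\<in>J. a j * z j))) =
    integral\<^sup>L prod_unif (\<lambda>z. b * F z + (\<Sum>j\<in>J. a j * (F z * z j)))"
    by (simp add: algebra_simps sum_distrib_left)
  also have "\<dots> = b * integral\<^sup>L prod_unif F + (\<Sum>j\<in>J. a j * integral\<^sup>L prod_unif (\<lambda>z. F z * z j))"
    using prod_unif.sq_int_integrable[OF F] prod_unif.sq_int_integrable[OF sq_int_mult_coord[OF F]]
    by (subst Bochner_Integration.integral_add) auto
  finally show ?thesis .
qed

text \<open>The functions \<open>1\<close> and \<open>z j\<close> are orthogonal, with squared norms \<open>1\<close> and \<open>1/3\<close>. Hence an affine
function is recovered from its moments: the constant is the mean, and the coefficient of \<open>z k\<close> is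
three times the moment against \<open>z k\<close>.\<close>

lemma integral_affine: "integral\<^sup>L prod_unif (\<lambda>z. b + (\<Sum>j\<in>J. a j * z j)) = b"
  using integral_mult_affine[OF prod_unif.sq_int_const[of 1], of b a J] by (simp add: prod_unif.prob_space[simplified])

lemma integral_affine_mult_coord:
  fixes J :: "'n::finite set"
  shows "integral\<^sup>L prod_unif (\<lambda>z. (b + (\<Sum>j\<in>J. a j * z j)) * z k) = (if k \<in> J then a k / 3 else 0)"
proof -
  have "integral\<^sup>L prod_unif (\<lambda>z. z k * (b + (\<Sum>j\<in>J. a j * z j))) = (\<Sum>j\<in>J. a j * (if k = j then 1/3 else 0))"
    by (subst integral_mult_affine[OF sq_int_coord]) (simp add: integral_coord_mult_coord)
  then show ?thesis by (simp add: mult.commute if_distrib cong: if_cong)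
qed

section \<open>Projection onto slicewise affine functions\<close>

definition slice_form :: "'n::finite \<Rightarrow> (real \<Rightarrow> real) \<Rightarrow> ('n \<Rightarrow> real \<Rightarrow> real) \<Rightarrow> ('n \<Rightarrow> real) \<Rightarrow> real" where
  "slice_form i B A z = B (z i) + (\<Sum>j\<in>UNIV - {i}. A j (z i) * z j)"

text \<open>Only almost all slices are inspected, and each only up to a null set. Hence the property passes
to almost everywhere equal functions, and the coefficients may depend on \<open>t\<close> in any way.\<close>

definition slice_affine :: "'n::finite \<Rightarrow> (('n \<Rightarrow> real) \<Rightarrow> real) \<Rightarrow> bool" where
  "slice_affine i G \<longleftrightarrow> (AE t in unif. \<exists>a b. AE z in prod_unif.
     G (z(i := t)) = b + (\<Sum>j\<in>UNIV - {i}. a j * z j))"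

text \<open>The orthogonal projection onto the slicewise affine functions. On each slice it is the projection
onto the span of the orthogonal functions \<open>1\<close> and \<open>z j\<close>; the factor \<open>3\<close> is the inverse of the second
moment of the uniform distribution on \<open>[-1, 1]\<close>.\<close>

definition slice_proj :: "'n::finite \<Rightarrow> (('n \<Rightarrow> real) \<Rightarrow> real) \<Rightarrow> ('n \<Rightarrow> real) \<Rightarrow> real" where
  "slice_proj i G = slice_form i
     (\<lambda>t. integral\<^sup>L prod_unif (\<lambda>z. G (z(i := t))))
     (\<lambda>j t. 3 * integral\<^sup>L prod_unif (\<lambda>z. G (z(i := t)) * z j))"

lemma slice_form_fun_upd:
  "slice_form i B A (z(i := t)) = B t + (\<Sum>j\<in>UNIV - {i}. A j t * z j)"
  unfolding slice_form_def by (auto intro!: sum.cong)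

lemma slice_affine_slice_form: "slice_affine i (slice_form i B A)"
  unfolding slice_affine_def slice_form_fun_upd
proof (rule AE_I2, intro exI)
  fix t
  show "AE z in prod_unif. B t + (\<Sum>j\<in>UNIV - {i}. A j t * z j) = B t + (\<Sum>j\<in>UNIV - {i}. A j t * z j)"
    by simp
qed

lemma slice_affine_diff:
  assumes "slice_affine i F" "slice_affine i G"
  shows "slice_affine i (\<lambda>z. F z - G z)"
  using assms unfolding slice_affine_def
proof eventually_elim
  case (elim t)
  then obtain a b a' b' where
    "AE z in prod_unif. F (z(i := t)) = b + (\<Sum>j\<in>UNIV - {i}. a j * z j)"
    "AE z in prod_unif. G (z(i := t)) = b' + (\<Sum>j\<in>UNIV - {i}. a' j * z j)"
    by blast
  then have "AE z in prod_unif. F (z(i := t)) - G (z(i := t)) =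
      (b - b') + (\<Sum>j\<in>UNIV - {i}. (a j - a' j) * z j)"
    by eventually_elim (simp add: left_diff_distrib sum_subtractf)
  then show ?case 
    by (intro exI[of _ "\<lambda>j. a j - a' j"] exI[of _ "b - b'"])
qed

lemma sq_int_slice_form:
  assumes "sq_int unif B" "\<And>j. sq_int unif (A j)"
  shows "sq_int prod_unif (slice_form i B A)"
  unfolding slice_form_def
  using assms by (intro sq_int_add sq_int_sum sq_int_mult_coord sq_int_of_coord) auto

lemma measurable_slice:
  assumes "F \<in> borel_measurable prod_unif"
  shows "(\<lambda>z. F (z(i := t))) \<in> borel_measurable prod_unif"
proof -
  have "(\<lambda>z. z(i := t)) \<in> prod_unif \<rightarrow>\<^sub>M prod_unif"
    by (rule measurable_fun_upd[where J = UNIV]) auto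
  then show ?thesis using assms by (rule measurable_compose)
qed

lemma AE_sq_int_slice:
  assumes "sq_int prod_unif F"
  shows "AE t in unif. sq_int prod_unif (\<lambda>z. F (z(i := t)))"
proof -
  have "AE t in unif. integrable prod_unif (\<lambda>z. (F (z(i := t)))\<^sup>2)"
    using assms by (intro AE_integrable_slice) (simp add: sq_int_def)
  then show ?thesis
    by eventually_elim (use assms measurable_slice in \<open>auto simp: sq_int_def\<close>)
qed

text \<open>By the Cauchy-Schwarz inequality on the slice, the square of the moment is at most the integral of
\<open>F\<^sup>2\<close> over the slice, which is integrable in \<open>t\<close>. With \<open>W = 1\<close> and \<open>W z = z j\<close> this shows that the
coefficients of \<^const>\<open>slice_proj\<close> are square integrable.\<close>

lemma sq_int_slice_moment:
  assumes F: "sq_int prod_unif F" and W: "W \<in> borel_measurable prod_unif" "AE z in prod_unif. \<bar>W z\<bar> \<le> 1"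
  shows "sq_int unif (\<lambda>t. integral\<^sup>L prod_unif (\<lambda>z. F (z(i := t)) * W z))"
  unfolding sq_int_def
proof
  have [measurable]: "F \<in> borel_measurable prod_unif" "W \<in> borel_measurable prod_unif"
    using F W by (auto simp: sq_int_def)
  have "(\<lambda>(t, z). F (z(i := t)) * W z) \<in> borel_measurable (unif \<Otimes>\<^sub>M prod_unif)"
    using measurable_compose[OF measurable_replace_coord[of i], of F borel]
    by (simp add: split_beta')
  then show m: "(\<lambda>t. integral\<^sup>L prod_unif (\<lambda>z. F (z(i := t)) * W z)) \<in> borel_measurable unif"
    by (rule prod_unif.borel_measurable_lebesgue_integral)
  show "integrable unif (\<lambda>t. (integral\<^sup>L prod_unif (\<lambda>z. F (z(i := t)) * W z))\<^sup>2)"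
  proof (rule Bochner_Integration.integrable_bound)
    show "integrable unif (\<lambda>t. integral\<^sup>L prod_unif (\<lambda>z. (F (z(i := t)))\<^sup>2))"
      using F by (intro integrable_slice_integral) (simp add: sq_int_def)
    show "(\<lambda>t. (integral\<^sup>L prod_unif (\<lambda>z. F (z(i := t)) * W z))\<^sup>2) \<in> borel_measurable unif"
      using m by measurable
    show "AE t in unif. norm ((integral\<^sup>L prod_unif (\<lambda>z. F (z(i := t)) * W z))\<^sup>2)
        \<le> norm (integral\<^sup>L prod_unif (\<lambda>z. (F (z(i := t)))\<^sup>2))"
      using AE_sq_int_slice[OF F, of i]
    proof eventually_elim
      case (elim t)
      have FW: "sq_int prod_unif (\<lambda>z. F (z(i := t)) * W z)"
        by (rule sq_int_mult_bounded[OF elim W])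
      have "(integral\<^sup>L prod_unif (\<lambda>z. F (z(i := t)) * W z))\<^sup>2
          \<le> integral\<^sup>L prod_unif (\<lambda>z. (F (z(i := t)) * W z)\<^sup>2)"
        by (rule prod_unif.expectation_squared_le[OF FW])
      also have "\<dots> \<le> integral\<^sup>L prod_unif (\<lambda>z. (F (z(i := t)))\<^sup>2)"
      proof (rule integral_mono_AE)
        show "integrable prod_unif (\<lambda>z. (F (z(i := t)) * W z)\<^sup>2)"
             "integrable prod_unif (\<lambda>z. (F (z(i := t)))\<^sup>2)"
          using FW elim by (auto simp: sq_int_def)
        show "AE z in prod_unif. (F (z(i := t)) * W z)\<^sup>2 \<le> (F (z(i := t)))\<^sup>2"
          using W(2) by eventually_elim (auto simp: power_mult_distrib abs_square_le_1 intro!: mult_left_le)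
      qed
      finally show ?case by simp
    qed
  qed
qed

lemma slice_projE:
  assumes G: "sq_int prod_unif G"
  obtains B A where "sq_int unif B" "\<And>j. sq_int unif (A j)" "slice_proj i G = slice_form i B A"
proof
  show "sq_int unif (\<lambda>t. integral\<^sup>L prod_unif (\<lambda>z. G (z(i := t))))"
    using sq_int_slice_moment[OF G, of "\<lambda>_. 1" i] by simp
  show "sq_int unif (\<lambda>t. 3 * integral\<^sup>L prod_unif (\<lambda>z. G (z(i := t)) * z j))" for j
    by (rule sq_int_cmult, rule sq_int_slice_moment[OF G measurable_coord AE_coord_bounded])
qed (rule slice_proj_def)

lemma sq_int_slice_proj:
  assumes "sq_int prod_unif G"
  shows "sq_int prod_unif (slice_proj i G)"
  using slice_projE[OF assms] sq_int_slice_form by metis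

lemma slice_affine_slice_proj: "slice_affine i (slice_proj i G)"
  unfolding slice_proj_def by (rule slice_affine_slice_form)

text \<open>Integrate over one slice at a time. On almost every slice \<open>G\<close> is an affine function, and \<open>F\<close> is
orthogonal to all of these.\<close>

lemma orthogonal_to_slice_affine:
  assumes F: "sq_int prod_unif F" and G: "sq_int prod_unif G" "slice_affine i G"
    and moments: "AE t in unif. integral\<^sup>L prod_unif (\<lambda>z. F (z(i := t))) = 0 \<and>
       (\<forall>j. j \<noteq> i \<longrightarrow> integral\<^sup>L prod_unif (\<lambda>z. F (z(i := t)) * z j) = 0)"
  shows "integral\<^sup>L prod_unif (\<lambda>z. F z * G z) = 0"
proof -
  have "AE t in unif. integral\<^sup>L prod_unif (\<lambda>z. F (z(i := t)) * G (z(i := t))) = 0"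
    using G(2)[unfolded slice_affine_def] moments AE_sq_int_slice[OF F, of i] AE_sq_int_slice[OF G(1), of i]
  proof eventually_elim
    case (elim t)
    then obtain a b where ab: "AE z in prod_unif. G (z(i := t)) = b + (\<Sum>j\<in>UNIV - {i}. a j * z j)"
      by blast
    have "integral\<^sup>L prod_unif (\<lambda>z. F (z(i := t)) * G (z(i := t))) =
      integral\<^sup>L prod_unif (\<lambda>z. F (z(i := t)) * (b + (\<Sum>j\<in>UNIV - {i}. a j * z j)))"
    proof (rule integral_cong_AE)
      show "(\<lambda>z. F (z(i := t)) * G (z(i := t))) \<in> borel_measurable prod_unif"
        using elim by (auto simp: sq_int_def)
      show "(\<lambda>z. F (z(i := t)) * (b + (\<Sum>j\<in>UNIV - {i}. a j * z j))) \<in> borel_measurable prod_unif"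
        using elim sq_int_affine[of b a "UNIV - {i}"] by (auto simp: sq_int_def)
      show "AE z in prod_unif. F (z(i := t)) * G (z(i := t)) =
          F (z(i := t)) * (b + (\<Sum>j\<in>UNIV - {i}. a j * z j))"
        using ab by eventually_elim simp
    qed
    also have "\<dots> = 0"
      using elim by (subst integral_mult_affine) auto
    finally show ?case .
  qed
  then have "integral\<^sup>L unif (\<lambda>t. integral\<^sup>L prod_unif (\<lambda>z. F (z(i := t)) * G (z(i := t)))) = 0"
    by (rule integral_eq_zero_AE)
  then show ?thesis
    using integral_slices[OF sq_int_mult_integrable[OF F G(1)], of i] by simp
qed

lemma slice_proj_minimal:
  assumes G: "sq_int prod_unif G" and f: "sq_int prod_unif f" "slice_affine i f"
  shows "integral\<^sup>L prod_unif (\<lambda>z. (G z - slice_proj i G z)\<^sup>2) \<le> integral\<^sup>L prod_unif (\<lambda>z. (G z - f z)\<^sup>2)"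
proof (rule pythagoras_le[OF G sq_int_slice_proj[OF G] f(1)], rule orthogonal_to_slice_affine)
  let ?P = "slice_proj i G"
  let ?B = "\<lambda>t. integral\<^sup>L prod_unif (\<lambda>z. G (z(i := t)))"
  let ?A = "\<lambda>j t. 3 * integral\<^sup>L prod_unif (\<lambda>z. G (z(i := t)) * z j)"
  show "sq_int prod_unif (\<lambda>z. G z - ?P z)" "sq_int prod_unif (\<lambda>z. ?P z - f z)"
    using sq_int_slice_proj[OF G] G f by (auto intro: sq_int_diff)
  show "slice_affine i (\<lambda>z. ?P z - f z)"
    using f(2) by (intro slice_affine_diff slice_affine_slice_proj)
  have P: "?P (z(i := t)) = ?B t + (\<Sum>j\<in>UNIV - {i}. ?A j t * z j)" for z t
    unfolding slice_proj_def by (rule slice_form_fun_upd)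
  show "AE t in unif. integral\<^sup>L prod_unif (\<lambda>z. G (z(i := t)) - ?P (z(i := t))) = 0 \<and>
    (\<forall>j. j \<noteq> i \<longrightarrow> integral\<^sup>L prod_unif (\<lambda>z. (G (z(i := t)) - ?P (z(i := t))) * z j) = 0)"
    using AE_sq_int_slice[OF G, of i]
  proof eventually_elim
    case (elim t)
    have lin: "sq_int prod_unif (\<lambda>z. ?B t + (\<Sum>j\<in>UNIV - {i}. ?A j t * z j))"
      by (rule sq_int_affine)
    have "integral\<^sup>L prod_unif (\<lambda>z. G (z(i := t)) - ?P (z(i := t))) = ?B t - ?B t"
      unfolding P by (subst Bochner_Integration.integral_diff)
        (auto intro: prod_unif.sq_int_integrable elim lin simp only: integral_affine)
    moreover have "integral\<^sup>L prod_unif (\<lambda>z. (G (z(i := t)) - ?P (z(i := t))) * z j) = 0" if "j \<noteq> i" for j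
    proof -
      have "integral\<^sup>L prod_unif (\<lambda>z. (G (z(i := t)) - ?P (z(i := t))) * z j) =
        integral\<^sup>L prod_unif (\<lambda>z. G (z(i := t)) * z j) -
        integral\<^sup>L prod_unif (\<lambda>z. (?B t + (\<Sum>j\<in>UNIV - {i}. ?A j t * z j)) * z j)"
        unfolding P left_diff_distrib
        by (rule Bochner_Integration.integral_diff)
           (intro prod_unif.sq_int_integrable sq_int_mult_coord elim lin)+
      also have "\<dots> = 0"
        using that by (subst integral_affine_mult_coord) simp
      finally show ?thesis .
    qed
    ultimately show ?case by simp
  qed
qed

text \<open>Slicing in direction \<open>i\<close> itself turns the integrand into an affine function with known moments.\<close>

lemma
  fixes i :: "'n::finite"
  assumes B: "sq_int unif B" and A: "\<And>j. sq_int unif (A j)"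
  shows integral_slice_form: "integral\<^sup>L prod_unif (slice_form i B A) = integral\<^sup>L unif B"
    and integral_slice_form_mult_same:
      "integral\<^sup>L prod_unif (\<lambda>z. slice_form i B A z * z i) = integral\<^sup>L unif (\<lambda>t. B t * t)"
    and integral_slice_form_mult_other:
      "k \<noteq> i \<Longrightarrow> integral\<^sup>L prod_unif (\<lambda>z. slice_form i B A z * z k) = integral\<^sup>L unif (A k) / 3"
proof -
  have s: "sq_int prod_unif (slice_form i B A)"
    by (rule sq_int_slice_form[OF B A])
  have i: "integrable prod_unif (slice_form i B A)" "integrable prod_unif (\<lambda>z. slice_form i B A z * z j)" for j
    by (intro prod_unif.sq_int_integrable sq_int_mult_coord s)+
  show "integral\<^sup>L prod_unif (slice_form i B A) = integral\<^sup>L unif B"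
    by (subst integral_slices[OF i(1), of i]) (simp only: slice_form_fun_upd integral_affine)
  show "integral\<^sup>L prod_unif (\<lambda>z. slice_form i B A z * z i) = integral\<^sup>L unif (\<lambda>t. B t * t)"
    by (subst integral_slices[OF i(2), of _ i])
       (simp only: slice_form_fun_upd fun_upd_same integral_mult_left_zero integral_affine)
  assume "k \<noteq> i"
  then show "integral\<^sup>L prod_unif (\<lambda>z. slice_form i B A z * z k) = integral\<^sup>L unif (A k) / 3"
    by (subst integral_slices[OF i(2), of _ i]) (simp add: slice_form_fun_upd integral_affine_mult_coord)
qed

text \<open>This computation carries the theorem. Fix the height \<open>t\<close> in direction \<open>b\<close>. The slice of
\<^term>\<open>slice_form a B A\<close> is again of the form \<^term>\<open>slice_form a B' A'\<close>, where the term with \<open>z b = t\<close>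
has moved into the constant coefficient. Averaging over \<open>z a\<close> replaces the arbitrary functions of \<open>z a\<close>
by their moments, so the coefficients of the projection become polynomials of degree at most one in
\<open>t\<close>: the projection has the form \<open>p + \<Sum>j. e j * z j + r * z a * z b\<close>.\<close>

lemma slice_proj_slice_form:
  fixes a b :: "'n::finite"
  assumes B: "sq_int unif B" and A: "\<And>j. sq_int unif (A j)" and ab: "a \<noteq> b"
  shows "slice_proj b (slice_form a B A) = slice_form b
    (\<lambda>t. integral\<^sup>L unif B + t * integral\<^sup>L unif (A b))
    (\<lambda>k t. if k = a then 3 * (integral\<^sup>L unif (\<lambda>s. B s * s) + t * integral\<^sup>L unif (\<lambda>s. A b s * s))
           else integral\<^sup>L unif (A k))"
proof
  fix z :: "'n \<Rightarrow> real"
  define B' where "B' t s = B s + t * A b s" for t s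
  define A' where "A' = A(b := \<lambda>_. 0)"
  have eq: "slice_form a B A (y(b := t)) = slice_form a (B' t) A' y" for y t
  proof -
    have "(\<Sum>j\<in>UNIV - {a}. A j (y a) * (y(b := t)) j) =
        A b (y a) * t + (\<Sum>j\<in>UNIV - {a} - {b}. A j (y a) * (y(b := t)) j)"
      using ab by (subst sum.remove[of _ b]) auto
    also have "(\<Sum>j\<in>UNIV - {a} - {b}. A j (y a) * (y(b := t)) j) = (\<Sum>j\<in>UNIV - {a} - {b}. A' j (y a) * y j)"
      by (rule sum.cong) (auto simp: A'_def)
    also have "\<dots> = (\<Sum>j\<in>UNIV - {a}. A' j (y a) * y j)"
      using ab by (subst (2) sum.remove[of _ b]) (auto simp: A'_def)
    finally show ?thesis
      using ab by (simp add: slice_form_def B'_def)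
  qed
  have B': "sq_int unif (B' t)" for t
    unfolding B'_def by (intro sq_int_add sq_int_cmult A B)
  have A': "sq_int unif (A' j)" for j
    using A unif.sq_int_const by (auto simp: A'_def)
  have mult_id: "sq_int unif f \<Longrightarrow> integrable unif (\<lambda>t. f t * t)" for f
    by (rule unif.sq_int_integrable, rule sq_int_mult_bounded[OF _ _ AE_unif_abs_le_1]) (auto simp: borel_measurable_unif)
  note i = unif.sq_int_integrable[OF B] unif.sq_int_integrable[OF A]
    mult_id[OF B] mult_id[OF A]
  have 0: "integral\<^sup>L prod_unif (\<lambda>y. slice_form a B A (y(b := t))) = integral\<^sup>L unif B + t * integral\<^sup>L unif (A b)" for t
    unfolding eq integral_slice_form[OF B' A'] unfolding B'_def using i by simp
  have 1: "integral\<^sup>L prod_unif (\<lambda>y. slice_form a B A (y(b := t)) * y a) =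
    integral\<^sup>L unif (\<lambda>s. B s * s) + t * integral\<^sup>L unif (\<lambda>s. A b s * s)" for t
    unfolding eq integral_slice_form_mult_same[OF B' A'] unfolding B'_def
    using i by (simp add: distrib_right mult.assoc)
  have 2: "integral\<^sup>L prod_unif (\<lambda>y. slice_form a B A (y(b := t)) * y k) = integral\<^sup>L unif (A k) / 3"
    if "k \<noteq> a" "k \<noteq> b" for t k
    unfolding eq integral_slice_form_mult_other[OF B' A' that(1)] using that by (simp add: A'_def)
  show "slice_proj b (slice_form a B A) z = slice_form b
    (\<lambda>t. integral\<^sup>L unif B + t * integral\<^sup>L unif (A b))
    (\<lambda>k t. if k = a then 3 * (integral\<^sup>L unif (\<lambda>s. B s * s) + t * integral\<^sup>L unif (\<lambda>s. A b s * s))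
           else integral\<^sup>L unif (A k)) z"
    unfolding slice_proj_def slice_form_def[of b] 0
    by (intro arg_cong2[where f = "(+)"] refl sum.cong) (auto simp: 1 2)
qed

section \<open>Iterated projections are affine\<close>

definition affine_proj :: "(('n::finite \<Rightarrow> real) \<Rightarrow> real) \<Rightarrow> ('n \<Rightarrow> real) \<Rightarrow> real" where
  "affine_proj G z = integral\<^sup>L prod_unif G +
     (\<Sum>j\<in>UNIV. 3 * integral\<^sup>L prod_unif (\<lambda>z. G z * z j) * z j)"

lemma sq_int_affine_proj: "sq_int prod_unif (affine_proj G)"
  unfolding affine_proj_def[abs_def] by (rule sq_int_affine)

lemma affine_proj_minimal:
  fixes G :: "('n::finite \<Rightarrow> real) \<Rightarrow> real"
  assumes G: "sq_int prod_unif G"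
  shows "integral\<^sup>L prod_unif (\<lambda>z. (G z - affine_proj G z)\<^sup>2)
    \<le> integral\<^sup>L prod_unif (\<lambda>z. (G z - (b + (\<Sum>j\<in>UNIV. a j * z j)))\<^sup>2)"
proof (rule pythagoras_le[OF G sq_int_affine_proj sq_int_affine])
  let ?F = "\<lambda>z. G z - affine_proj G z"
  let ?m = "\<lambda>j. integral\<^sup>L prod_unif (\<lambda>z. G z * z j)"
  have F: "sq_int prod_unif ?F"
    by (rule sq_int_diff[OF G sq_int_affine_proj])
  have "integral\<^sup>L prod_unif ?F = integral\<^sup>L prod_unif G - integral\<^sup>L prod_unif (affine_proj G)"
    by (rule Bochner_Integration.integral_diff) (intro prod_unif.sq_int_integrable G sq_int_affine_proj)+
  then have 0: "integral\<^sup>L prod_unif ?F = 0"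
    unfolding affine_proj_def integral_affine by simp
  have 1: "integral\<^sup>L prod_unif (\<lambda>z. ?F z * z j) = 0" for j
  proof -
    have "integral\<^sup>L prod_unif (\<lambda>z. ?F z * z j) =
        integral\<^sup>L prod_unif (\<lambda>z. G z * z j) - integral\<^sup>L prod_unif (\<lambda>z. affine_proj G z * z j)"
      unfolding left_diff_distrib
      by (rule Bochner_Integration.integral_diff)
         (intro prod_unif.sq_int_integrable sq_int_mult_coord G sq_int_affine_proj)+
    then show ?thesis
      unfolding affine_proj_def integral_affine_mult_coord by simp
  qed
  have "integral\<^sup>L prod_unif (\<lambda>z. ?F z * (affine_proj G z - (b + (\<Sum>j\<in>UNIV. a j * z j)))) =
    integral\<^sup>L prod_unif (\<lambda>z. ?F z * ((integral\<^sup>L prod_unif G - b) + (\<Sum>j\<in>UNIV. (3 * ?m j - a j) * z j)))"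
  proof (intro Bochner_Integration.integral_cong refl arg_cong2[where f = "(*)"])
    fix z :: "'n \<Rightarrow> real"
    show "affine_proj G z - (b + (\<Sum>j\<in>UNIV. a j * z j)) =
        (integral\<^sup>L prod_unif G - b) + (\<Sum>j\<in>UNIV. (3 * ?m j - a j) * z j)"
      by (simp add: affine_proj_def left_diff_distrib sum_subtractf)
  qed
  also have "\<dots> = 0"
    unfolding integral_mult_affine[OF F] 0 1 by simp
  finally show "integral\<^sup>L prod_unif (\<lambda>z. ?F z * (affine_proj G z - (b + (\<Sum>j\<in>UNIV. a j * z j)))) = 0" .
qed

lemma sq_int_unif_affine: "sq_int unif (\<lambda>t. p + t * q)"
proof -
  have "sq_int unif (\<lambda>t. q * t)"
    by (intro sq_int_mult_bounded unif.sq_int_const AE_unif_abs_le_1) (auto simp: borel_measurable_unif)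
  then show ?thesis
    by (intro sq_int_add unif.sq_int_const) (simp add: mult.commute)
qed

text \<open>After two projections the only term that is not affine is a multiple of \<open>z a * z b\<close>, by
\<open>slice_proj_slice_form\<close>. A third direction \<open>c\<close> removes it, since on slices of height \<open>z c\<close> the product
\<open>z a * z b\<close> is orthogonal to \<open>1\<close> and to every coordinate. This is where \<open>d \<ge> 3\<close> is needed: the function
\<open>z a * z b\<close> in two variables is affine on every line parallel to an axis.\<close>

lemma slice_proj_thrice_affine:
  fixes a b c :: "'n::finite"
  assumes G: "sq_int prod_unif G" and abc: "a \<noteq> b" "a \<noteq> c" "b \<noteq> c"
  obtains \<beta> \<alpha> where "slice_proj c (slice_proj b (slice_proj a G)) = (\<lambda>z. \<beta> + (\<Sum>j\<in>UNIV. \<alpha> j * z j))"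
proof -
  obtain B A where BA: "sq_int unif B" "\<And>j. sq_int unif (A j)" "slice_proj a G = slice_form a B A"
    using slice_projE[OF G] by metis
  define B' where "B' t = integral\<^sup>L unif B + t * integral\<^sup>L unif (A b)" for t
  define A' where "A' k t = (if k = a then
      3 * (integral\<^sup>L unif (\<lambda>s. B s * s) + t * integral\<^sup>L unif (\<lambda>s. A b s * s))
    else integral\<^sup>L unif (A k))" for k t
  have 1: "slice_proj b (slice_proj a G) = slice_form b B' A'"
    unfolding BA(3) slice_proj_slice_form[OF BA(1,2) abc(1)] B'_def A'_def ..
  have B': "sq_int unif B'"
    unfolding B'_def by (rule sq_int_unif_affine)
  have A': "sq_int unif (A' j)" for j
  proof (cases "j = a")
    case True
    show ?thesis
      unfolding A'_def True if_P[OF refl] by (intro sq_int_cmult sq_int_unif_affine)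
  qed (simp add: A'_def[abs_def] unif.sq_int_const)
\<comment> \<open>The coefficient of \<open>z c\<close> after two projections is a constant because \<open>c \<noteq> a\<close>.\<close>
  have A'c: "integral\<^sup>L unif (\<lambda>s. A' c s * s) = 0"
    using abc(2) by (simp add: A'_def unif_mean)
  define \<alpha> where "\<alpha> k = (if k = b then 3 * integral\<^sup>L unif (\<lambda>s. B' s * s) else integral\<^sup>L unif (A' k))" for k
  have "slice_proj c (slice_proj b (slice_proj a G)) z = integral\<^sup>L unif B' + (\<Sum>j\<in>UNIV. \<alpha> j * z j)" for z
  proof -
    have "(\<Sum>j\<in>UNIV. \<alpha> j * z j) = \<alpha> c * z c + (\<Sum>j\<in>UNIV - {c}. \<alpha> j * z j)"
      by (rule sum.remove) auto
    then show ?thesis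
      unfolding 1 slice_proj_slice_form[OF B' A' abc(3)] slice_form_def A'c
      using abc(3) by (simp add: \<alpha>_def if_distrib mult.commute cong: if_cong)
  qed
  then show thesis by (intro that ext)
qed

text \<open>Choose three directions and put \<open>f = P\<^sub>a G\<close>, \<open>q = P\<^sub>b f\<close> and \<open>l = P\<^sub>c q\<close>, where \<open>P\<^sub>i\<close> stands for
\<^term>\<open>slice_proj i\<close>. The function \<open>l\<close> is affine, so its distance to \<open>G\<close> bounds the one on the
left. Each step costs little: by minimality, \<open>P\<^sub>b f\<close> is at least as close to \<open>f\<close> as
\<open>P\<^sub>b G\<close> is, and the latter is close to \<open>G\<close>, hence to \<open>f\<close>; the same comparison applies to
\<open>P\<^sub>c q\<close>.\<close>

lemma affine_distance_le:
  fixes G :: "('n::finite \<Rightarrow> real) \<Rightarrow> real"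
  assumes G: "sq_int prod_unif G" and card: "CARD('n) \<ge> 3"
  shows "integral\<^sup>L prod_unif (\<lambda>z. (G z - affine_proj G z)\<^sup>2)
    \<le> 36 * (\<Sum>i\<in>UNIV. integral\<^sup>L prod_unif (\<lambda>z. (G z - slice_proj i G z)\<^sup>2))"
proof -
  obtain T :: "'n set" where "card T = 3"
    using obtain_subset_with_card_n[OF card] by metis
  then obtain a b c :: 'n where abc: "a \<noteq> b" "a \<noteq> c" "b \<noteq> c"
    by (auto simp: card_Suc_eq numeral_3_eq_3)
  define D where "D F H = integral\<^sup>L prod_unif (\<lambda>z. (F z - H z)\<^sup>2)" for F H :: "('n \<Rightarrow> real) \<Rightarrow> real"
  have D_commute: "D F H = D H F" for F H
    unfolding D_def by (simp add: power2_commute)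
  have D_triangle: "D F H \<le> 2 * D F K + 2 * D K H"
    if "sq_int prod_unif F" "sq_int prod_unif K" "sq_int prod_unif H" for F H K
    using integral_square_add_le[OF sq_int_diff[OF that(1,2)] sq_int_diff[OF that(2,3)]]
    by (simp add: D_def)
  note sq = sq_int_slice_proj
  define f q l where "f = slice_proj a G" and "q = slice_proj b f" and "l = slice_proj c q"
  have f: "sq_int prod_unif f" and q: "sq_int prod_unif q" and l: "sq_int prod_unif l"
    unfolding f_def q_def l_def by (intro sq G)+
  let ?e = "\<lambda>i. D G (slice_proj i G)"
  have "D f q \<le> D f (slice_proj b G)"
    unfolding D_def q_def by (rule slice_proj_minimal[OF f sq[OF G] slice_affine_slice_proj])
  also have "\<dots> \<le> 2 * ?e a + 2 * ?e b"
    using D_triangle[OF f G sq[OF G, of b]] by (simp add: f_def D_commute)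
  finally have fq: "D f q \<le> 2 * ?e a + 2 * ?e b" .
  have Gq: "D G q \<le> 6 * ?e a + 4 * ?e b"
    using D_triangle[OF G f q] fq by (simp add: f_def)
  have "D q l \<le> D q (slice_proj c G)"
    unfolding D_def l_def by (rule slice_proj_minimal[OF q sq[OF G] slice_affine_slice_proj])
  also have "\<dots> \<le> 2 * D G q + 2 * ?e c"
    using D_triangle[OF q G sq[OF G, of c]] by (simp add: D_commute)
  finally have ql: "D q l \<le> 12 * ?e a + 8 * ?e b + 2 * ?e c"
    using Gq by linarith
  obtain \<beta> \<alpha> where l_affine: "l = (\<lambda>z. \<beta> + (\<Sum>j\<in>UNIV. \<alpha> j * z j))"
    unfolding l_def q_def f_def using slice_proj_thrice_affine[OF G abc] by metis
  have e_nonneg: "0 \<le> ?e i" for i by (simp add: D_def)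
  have "D G (affine_proj G) \<le> D G l"
    unfolding D_def l_affine by (rule affine_proj_minimal[OF G])
  also have "\<dots> \<le> 2 * D G q + 2 * D q l"
    by (rule D_triangle[OF G q l])
  also have "\<dots> \<le> 36 * (?e a + ?e b + ?e c)"
    using Gq ql e_nonneg[of b] e_nonneg[of c] by simp
  also have "?e a + ?e b + ?e c = (\<Sum>i\<in>{a, b, c}. ?e i)"
    using abc by simp
  also have "\<dots> \<le> (\<Sum>i\<in>UNIV. ?e i)"
    by (rule sum_mono2) (auto simp: e_nonneg)
  finally show ?thesis by (simp add: D_def)
qed

section \<open>Transfer to Lebesgue measure on the cube\<close>

lemma measurable_vec_lambda:
  "vec_lambda \<in> PiM UNIV (\<lambda>_. lborel) \<rightarrow>\<^sub>M (borel :: (real ^ 'n::finite) measure)"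
  by (subst borel_measurable_euclidean_space) (auto simp: Basis_vec_def inner_axis)

lemma product_sigma_finite_lborel: "product_sigma_finite (\<lambda>_. lborel :: real measure)"
  by (rule product_sigma_finite.intro) (rule lborel.sigma_finite_measure_axioms)

text \<open>The two measures agree on boxes.\<close>

lemma distr_vec_lambda: "distr (PiM UNIV (\<lambda>_. lborel)) borel vec_lambda = (lborel :: (real ^ 'n) measure)"
proof (rule lborel_eqI[symmetric])
  show "emeasure (distr (PiM UNIV (\<lambda>_. lborel)) borel vec_lambda) (box l u) = (\<Prod>b\<in>Basis. (u - l) \<bullet> b)"
    if le: "\<And>b. b \<in> Basis \<Longrightarrow> l \<bullet> b \<le> u \<bullet> b" for l u :: "real ^ 'n"
  proof -
    have le': "l $ i \<le> u $ i" for i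
      using le[of "axis i 1"] by (simp add: inner_axis)
    have "emeasure (distr (PiM UNIV (\<lambda>_. lborel)) borel vec_lambda) (box l u)
        = emeasure (PiM UNIV (\<lambda>_. lborel)) (Pi\<^sub>E UNIV (\<lambda>i. {l $ i <..< u $ i}))"
      by (subst emeasure_distr[OF measurable_vec_lambda])
         (auto intro!: arg_cong[where f = "emeasure _"] simp: mem_box_cart space_PiM PiE_iff)
    also have "\<dots> = (\<Prod>i\<in>UNIV. ennreal (u $ i - l $ i))"
      by (subst product_sigma_finite.emeasure_PiM[OF product_sigma_finite_lborel]) (auto simp: le')
    also have "\<dots> = ennreal (\<Prod>i\<in>UNIV. u $ i - l $ i)"
      by (rule prod_ennreal) (simp add: le')
    also have "(\<Prod>i\<in>UNIV. u $ i - l $ i) = (\<Prod>b\<in>Basis. (u - l) \<bullet> b)"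
      by (simp add: Basis_vec_def UNION_singleton_eq_range prod.reindex axis_eq_axis inj_on_def inner_axis)
    finally show ?thesis .
  qed
qed simp

lemma sets_PiM_lborel: "sets (PiM UNIV (\<lambda>_. lborel)) = sets prod_unif"
  by (rule sets_PiM_cong) auto

lemma emeasure_PiM_lborel_cube: 
  "emeasure (PiM UNIV (\<lambda>_::'n::finite. lborel)) (Pi\<^sub>E UNIV (\<lambda>_. {-1..1::real})) = 2 ^ CARD('n)"
  by (subst product_sigma_finite.emeasure_PiM[OF product_sigma_finite_lborel]) auto

lemma prod_unif_eq_uniform_measure:
  "(prod_unif :: ('n::finite \<Rightarrow> real) measure) =
     uniform_measure (PiM UNIV (\<lambda>_. lborel)) (Pi\<^sub>E UNIV (\<lambda>_. {-1..1}))"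
proof (rule sym, rule product_sigma_finite.PiM_eqI)
  show "product_sigma_finite (\<lambda>_::'n. unif)"
    by (rule product_sigma_finite.intro) (rule unif.sigma_finite_measure_axioms)
  let ?J = "PiM UNIV (\<lambda>_::'n. lborel :: real measure)" and ?Q = "Pi\<^sub>E UNIV (\<lambda>_::'n. {-1..1::real})"
  fix A :: "'n \<Rightarrow> real set" assume A: "\<And>i. i \<in> UNIV \<Longrightarrow> A i \<in> sets unif"
  have A' [measurable]: "A i \<in> sets borel" for i using A[of i] by simp
  have Q: "?Q \<in> sets ?J" by (intro sets_PiM_I_finite) auto
  have "emeasure (uniform_measure ?J ?Q) (Pi\<^sub>E UNIV A) = emeasure ?J (Pi\<^sub>E UNIV (\<lambda>i. {-1..1} \<inter> A i)) / 2 ^ CARD('n)"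
    by (subst emeasure_uniform_measure[OF Q])
       (auto intro!: sets_PiM_I_finite simp: emeasure_PiM_lborel_cube PiE_Int)
  also have "emeasure ?J (Pi\<^sub>E UNIV (\<lambda>i. {-1..1} \<inter> A i)) = (\<Prod>i\<in>UNIV. emeasure lborel ({-1..1} \<inter> A i))"
    by (subst product_sigma_finite.emeasure_PiM[OF product_sigma_finite_lborel]) auto
  also have "\<dots> / 2 ^ CARD('n) = (\<Prod>i\<in>UNIV. emeasure lborel ({-1..1} \<inter> A i) / 2)"
    by (simp add: divide_ennreal_def prod.distrib ennreal_inverse_power)
  also have "\<dots> = (\<Prod>i\<in>UNIV. emeasure unif (A i))"
    by (simp add: unif_def)
  finally show "emeasure (uniform_measure ?J ?Q) (Pi\<^sub>E UNIV A) = (\<Prod>i\<in>UNIV. emeasure unif (A i))" .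
qed (auto intro!: sets_PiM_cong)

lemma prod_unif_density:
  "(prod_unif :: ('n::finite \<Rightarrow> real) measure) =
     density (PiM UNIV (\<lambda>_. lborel)) (\<lambda>z. ennreal (indicator (Pi\<^sub>E UNIV (\<lambda>_. {-1..1})) z / 2 ^ CARD('n)))"
proof -
  let ?J = "PiM UNIV (\<lambda>_::'n. lborel :: real measure)" and ?Q = "Pi\<^sub>E UNIV (\<lambda>_::'n. {-1..1::real})"
  have Q [measurable]: "?Q \<in> sets ?J" by (intro sets_PiM_I_finite) auto
  have "(1 :: ennreal) / 2 ^ CARD('n) = ennreal (1 / 2 ^ CARD('n))"
    by (simp add: divide_ennreal[symmetric] ennreal_power[symmetric])
  then show ?thesis
    unfolding prod_unif_eq_uniform_measure uniform_measure_def emeasure_PiM_lborel_cube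
    by (intro density_cong) (auto simp: indicator_def)
qed

lemma measurable_vec_nth [measurable]: "vec_nth \<in> borel \<rightarrow>\<^sub>M (prod_unif :: ('n::finite \<Rightarrow> real) measure)"
  by (rule measurable_PiM_single'[where f = "\<lambda>i x. x $ i"]) auto

lemma vec_lambda_in_cube: "vec_lambda z \<in> cube \<longleftrightarrow> z \<in> Pi\<^sub>E UNIV (\<lambda>_. {-1..1})"
  by (auto simp: cube_def mem_box_cart PiE_iff)

lemma cube_sets [measurable, simp]: "cube \<in> sets borel" "cube \<in> sets lebesgue"
  by (auto simp: cube_def)

lemma
  fixes F :: "('n::finite \<Rightarrow> real) \<Rightarrow> real"
  assumes F [measurable]: "F \<in> borel_measurable prod_unif"
  shows integrable_cube_iff: "integrable (lebesgue_on cube) (\<lambda>x. F (vec_nth x)) \<longleftrightarrow> integrable prod_unif F"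
    and integral_cube: "integral\<^sup>L (lebesgue_on cube) (\<lambda>x. F (vec_nth x)) = 2 ^ CARD('n) * integral\<^sup>L prod_unif F"
proof -
  let ?J = "PiM UNIV (\<lambda>_::'n. lborel :: real measure)" and ?Q = "Pi\<^sub>E UNIV (\<lambda>_::'n. {-1..1::real})"
  define H where "H x = indicator cube x *\<^sub>R F (vec_nth x)" for x :: "real ^ 'n"
  have H [measurable]: "H \<in> borel_measurable borel"
    unfolding H_def by measurable
  have H_vec: "H (vec_lambda z) = indicator ?Q z * F z" for z
    using vec_lambda_inverse[of z] by (simp add: H_def vec_lambda_in_cube indicator_def)
  have FJ: "F \<in> borel_measurable ?J"
    using F by (subst measurable_cong_sets[OF sets_PiM_lborel refl])
  have Q: "?Q \<in> sets ?J" by (intro sets_PiM_I_finite) auto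
  have gm: "(\<lambda>z. indicator ?Q z / 2 ^ CARD('n) :: real) \<in> borel_measurable ?J"
    using Q by (intro borel_measurable_divide) auto
  have "integrable (lebesgue_on cube) (\<lambda>x. F (vec_nth x)) \<longleftrightarrow> integrable lebesgue H"
    unfolding H_def by (rule integrable_restrict_space) auto
  also have "\<dots> \<longleftrightarrow> integrable lborel H"
    by (rule integrable_completion) simp
  also have "\<dots> \<longleftrightarrow> integrable ?J (\<lambda>z. H (vec_lambda z))"
    unfolding distr_vec_lambda[symmetric] by (rule integrable_distr_eq[OF measurable_vec_lambda H])
  also have "\<dots> \<longleftrightarrow> integrable ?J (\<lambda>z. (indicator ?Q z / 2 ^ CARD('n)) *\<^sub>R F z)"
    using integrable_mult_left_iff[of ?J "1 / 2 ^ CARD('n)" "\<lambda>z. indicator ?Q z * F z"]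
    by (simp add: H_vec)
  also have "\<dots> \<longleftrightarrow> integrable prod_unif F"
    unfolding prod_unif_density by (rule integrable_density[symmetric, OF FJ gm]) simp
  finally show "integrable (lebesgue_on cube) (\<lambda>x. F (vec_nth x)) \<longleftrightarrow> integrable prod_unif F" .
  have "integral\<^sup>L (lebesgue_on cube) (\<lambda>x. F (vec_nth x)) = integral\<^sup>L lebesgue H"
    unfolding H_def by (rule integral_restrict_space) auto
  also have "\<dots> = integral\<^sup>L lborel H"
    by (rule integral_completion) simp
  also have "\<dots> = integral\<^sup>L ?J (\<lambda>z. H (vec_lambda z))"
    unfolding distr_vec_lambda[symmetric] by (rule integral_distr[OF measurable_vec_lambda H])
  also have "\<dots> = 2 ^ CARD('n) * integral\<^sup>L ?J (\<lambda>z. (indicator ?Q z / 2 ^ CARD('n)) *\<^sub>R F z)"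
    by (simp add: H_vec)
  also have "integral\<^sup>L ?J (\<lambda>z. (indicator ?Q z / 2 ^ CARD('n)) *\<^sub>R F z) = integral\<^sup>L prod_unif F"
    unfolding prod_unif_density by (rule integral_density[symmetric, OF FJ gm]) simp
  finally show "integral\<^sup>L (lebesgue_on cube) (\<lambda>x. F (vec_nth x)) = 2 ^ CARD('n) * integral\<^sup>L prod_unif F" .
qed

text \<open>The predicate \<open>P\<close> may be non-measurable: an exceptional set for Lebesgue measure lies in a Borel null
set, and only the latter has to be pulled back. This matters for the slicewise affine functions, whose
coefficients are arbitrary functions of the height.\<close>

lemma AE_cube_imp_AE_prod_unif:
  fixes P :: "real ^ 'n::finite \<Rightarrow> bool"
  assumes "AE x in lebesgue_on cube. P x"
  shows "AE z in prod_unif. P (vec_lambda z)"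
proof -
  let ?J = "PiM UNIV (\<lambda>_::'n. lborel :: real measure)" and ?Q = "Pi\<^sub>E UNIV (\<lambda>_::'n. {-1..1::real})"
  have "AE x in lebesgue. x \<in> cube \<longrightarrow> P x"
    using assms by (subst (asm) AE_restrict_space_iff) auto
  then have "AE x in distr ?J borel vec_lambda. x \<in> cube \<longrightarrow> P x"
    unfolding distr_vec_lambda AE_completion_iff .
  then have "AE z in ?J. vec_lambda z \<in> cube \<longrightarrow> P (vec_lambda z)"
    by (rule AE_distrD[OF measurable_vec_lambda])
  then show ?thesis
    unfolding prod_unif_eq_uniform_measure
    by (intro AE_uniform_measureI) (auto simp: vec_lambda_in_cube intro!: sets_PiM_I_finite)
qed

text \<open>Links a Lebesgue measurable function on vectors with a function that is Borel measurable on the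
product space. Values off the cube are unconstrained on both sides.\<close>

definition represents :: "((real ^ 'n::finite) \<Rightarrow> real) \<Rightarrow> (('n \<Rightarrow> real) \<Rightarrow> real) \<Rightarrow> bool" where
  "represents f F \<longleftrightarrow> sq_int prod_unif F \<and> (AE x in lebesgue_on cube. f x = F (vec_nth x))"

lemma represents_vec_nth:
  assumes "sq_int prod_unif F"
  shows "represents (\<lambda>x. F (vec_nth x)) F" "(\<lambda>x. F (vec_nth x)) \<in> L2_cube"
proof -
  have "(\<lambda>x. F (vec_nth x)) \<in> borel_measurable borel"
    using assms measurable_vec_nth by (auto simp: sq_int_def)
  then have "(\<lambda>x. F (vec_nth x)) \<in> borel_measurable (lebesgue_on cube)"
    by (intro measurable_restrict_space1 measurable_completion) simp
  then show "(\<lambda>x. F (vec_nth x)) \<in> L2_cube"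
    using assms integrable_cube_iff[of "\<lambda>z. (F z)\<^sup>2"] borel_measurable_power[of F prod_unif 2]
    by (simp add: L2_cube_def sq_int_def)
  show "represents (\<lambda>x. F (vec_nth x)) F"
    using assms by (simp add: represents_def)
qed

text \<open>A Lebesgue measurable function is almost everywhere equal to a Borel function.\<close>

lemma L2_cube_represents:
  assumes f: "f \<in> L2_cube"
  obtains F where "represents f F"
proof -
  have fm: "f \<in> borel_measurable (lebesgue_on cube)" and fi: "integrable (lebesgue_on cube) (\<lambda>x. (f x)\<^sup>2)"
    using f by (auto simp: L2_cube_def)
  have "(\<lambda>x. indicator cube x *\<^sub>R f x) \<in> borel_measurable (completion lborel)"
    using fm by (subst (asm) borel_measurable_restrict_space_iff) auto
  then obtain g where g: "g \<in> borel_measurable lborel" "AE x in lborel. indicator cube x *\<^sub>R f x = g x"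
    using completion_ex_borel_measurable_real by metis
  define F where "F z = g (vec_lambda z)" for z
  have "vec_lambda \<in> prod_unif \<rightarrow>\<^sub>M borel"
    using measurable_vec_lambda by (simp only: measurable_cong_sets[OF sets_PiM_lborel refl])
  then have Fm: "F \<in> borel_measurable prod_unif"
    unfolding F_def using g(1) by measurable
  have "AE x in lebesgue. indicator cube x *\<^sub>R f x = g x"
    using g(2) by (rule AE_completion)
  then have "AE x in lebesgue. x \<in> cube \<longrightarrow> f x = F (vec_nth x)"
    by eventually_elim (auto simp: F_def)
  then have ae: "AE x in lebesgue_on cube. f x = F (vec_nth x)"
    by (subst AE_restrict_space_iff) auto
  have Fm2: "(\<lambda>z. (F z)\<^sup>2) \<in> borel_measurable prod_unif"
    using Fm by measurable
  have "integrable (lebesgue_on cube) (\<lambda>x. (F (vec_nth x))\<^sup>2)"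
  proof (rule integrable_cong_AE_imp[OF fi])
    have "(\<lambda>x. (F (vec_nth x))\<^sup>2) \<in> borel_measurable borel"
      using Fm2 measurable_vec_nth by simp
    then show "(\<lambda>x. (F (vec_nth x))\<^sup>2) \<in> borel_measurable (lebesgue_on cube)"
      by (intro measurable_restrict_space1 measurable_completion) simp
    show "AE x in lebesgue_on cube. (f x)\<^sup>2 = (F (vec_nth x))\<^sup>2"
      using ae by eventually_elim simp
  qed
  then have "integrable prod_unif (\<lambda>z. (F z)\<^sup>2)"
    using integrable_cube_iff[OF Fm2] by simp
  then show thesis
    using Fm ae by (intro that[of F]) (simp add: represents_def sq_int_def)
qed

lemma L2_norm_represents:
  fixes f g :: "real ^ 'n::finite \<Rightarrow> real"
  assumes f: "f \<in> L2_cube" "represents f F" and g: "g \<in> L2_cube" "represents g G"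
  shows "L2_norm (\<lambda>x. f x - g x) = sqrt (2 ^ CARD('n) * integral\<^sup>L prod_unif (\<lambda>z. (F z - G z)\<^sup>2))"
proof -
  have d: "sq_int prod_unif (\<lambda>z. F z - G z)"
    using f g by (auto simp: represents_def intro: sq_int_diff)
  have "integral\<^sup>L (lebesgue_on cube) (\<lambda>x. (f x - g x)\<^sup>2) =
      integral\<^sup>L (lebesgue_on cube) (\<lambda>x. (F (vec_nth x) - G (vec_nth x))\<^sup>2)"
  proof (rule integral_cong_AE)
    show "(\<lambda>x. (f x - g x)\<^sup>2) \<in> borel_measurable (lebesgue_on cube)"
      using f g by (auto simp: L2_cube_def)
    show "(\<lambda>x. (F (vec_nth x) - G (vec_nth x))\<^sup>2) \<in> borel_measurable (lebesgue_on cube)"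
      using represents_vec_nth(2)[OF d] by (auto simp: L2_cube_def)
    show "AE x in lebesgue_on cube. (f x - g x)\<^sup>2 = (F (vec_nth x) - G (vec_nth x))\<^sup>2"
      using conjunct2[OF f(2)[unfolded represents_def]] conjunct2[OF g(2)[unfolded represents_def]]
      by eventually_elim simp
  qed
  also have "\<dots> = 2 ^ CARD('n) * integral\<^sup>L prod_unif (\<lambda>z. (F z - G z)\<^sup>2)"
    using d by (intro integral_cube borel_measurable_power) (simp add: sq_int_def)
  finally show ?thesis by (simp add: L2_norm_def)
qed

lemma nearest_represents:
  assumes g: "g \<in> L2_cube" "represents g G"
    and S: "S \<subseteq> L2_cube"
    and P: "sq_int prod_unif P" "(\<lambda>x. P (vec_nth x)) \<in> S"
    and minimal: "\<And>f F. f \<in> S \<Longrightarrow> represents f F \<Longrightarrow>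
      integral\<^sup>L prod_unif (\<lambda>z. (G z - P z)\<^sup>2) \<le> integral\<^sup>L prod_unif (\<lambda>z. (G z - F z)\<^sup>2)"
  shows "nearest S g (\<lambda>x. P (vec_nth x))"
  unfolding nearest_def is_arg_min_def
proof (intro conjI notI)
  assume "\<exists>f. f \<in> S \<and> L2_norm (\<lambda>x. g x - f x) < L2_norm (\<lambda>x. g x - P (vec_nth x))"
  then obtain f where f: "f \<in> S" "L2_norm (\<lambda>x. g x - f x) < L2_norm (\<lambda>x. g x - P (vec_nth x))"
    by blast
  then obtain F where F: "represents f F"
    using S L2_cube_represents by blast
  have fL: "f \<in> L2_cube" using f(1) S by blast
  show False
    using f(2) minimal[OF f(1) F] 
    unfolding L2_norm_represents[OF g fL F] L2_norm_represents[OF g represents_vec_nth(2,1)[OF P(1)]]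
    by simp
qed (fact P(2))

text \<open>Fubini turns almost everywhere equality on the cube into almost everywhere equality on almost every
slice.\<close>

lemma SAff_represents_slice_affine:
  fixes f :: "real ^ 'n::finite \<Rightarrow> real"
  assumes f: "f \<in> SAff i" and F: "represents f F"
  shows "slice_affine i F"
proof -
  obtain h where h: "affine_on_planes i h" "AE x in lebesgue_on cube. f x = h x"
    using f by (auto simp: SAff_def)
  have "AE x in lebesgue_on cube. F (vec_nth x) = h x"
    using h(2) conjunct2[OF F[unfolded represents_def]] by eventually_elim simp
  from AE_cube_imp_AE_prod_unif[OF this]
  have "AE z in prod_unif. F z = h (vec_lambda z)"
    by (simp add: vec_lambda_inverse)
  from AE_slices[OF this, of i] AE_unif_bounded show ?thesis
    unfolding slice_affine_def
  proof eventually_elim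
    case (elim t)
\<comment> \<open>The plane of height \<open>t\<close> is the translate by \<open>t\<close> times the unit vector in direction \<open>i\<close>.\<close>
    obtain a b where ab: "\<And>x. x \<in> cube \<Longrightarrow> x \<in> (+) (axis i t) ` coord_plane i \<Longrightarrow>
        h x = b + (\<Sum>j\<in>UNIV - {i}. a j * x $ j)"
      using h(1) unfolding affine_on_planes_def by blast
    have "AE z in prod_unif. F (z(i := t)) = b + (\<Sum>j\<in>UNIV - {i}. a j * z j)"
      using elim(1) AE_prod_unif_bounded
    proof eventually_elim
      case (elim z)
      let ?x = "vec_lambda (z(i := t)) :: real ^ 'n"
      have "?x \<in> cube"
        using elim(2) \<open>t \<in> {-1..1}\<close> by (auto simp: vec_lambda_in_cube PiE_iff)
      moreover have "?x = axis i t + (?x - axis i t)" "?x - axis i t \<in> coord_plane i"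
        by (auto simp: coord_plane_def axis_def)
      then have "?x \<in> (+) (axis i t) ` coord_plane i" by blast
      ultimately have "h ?x = b + (\<Sum>j\<in>UNIV - {i}. a j * ?x $ j)"
        by (rule ab)
      also have "(\<Sum>j\<in>UNIV - {i}. a j * ?x $ j) = (\<Sum>j\<in>UNIV - {i}. a j * z j)"
        by (rule sum.cong) (auto simp: vec_lambda_beta)
      finally show ?case unfolding elim(1) .
    qed
    then show ?case by blast
  qed
qed

lemma slice_form_in_SAff:
  assumes "sq_int prod_unif (slice_form i B A)"
  shows "(\<lambda>x. slice_form i B A (vec_nth x)) \<in> SAff i"
proof -
  have "affine_on_planes i (\<lambda>x. slice_form i B A (vec_nth x))"
    unfolding affine_on_planes_def
  proof
    fix v :: "real ^ 'a"
    show "\<exists>a b. \<forall>x\<in>cube \<inter> (+) v ` coord_plane i.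
        slice_form i B A (vec_nth x) = b + (\<Sum>j\<in>UNIV - {i}. a j * x $ j)"
      by (rule exI[of _ "\<lambda>j. A j (v $ i)"], rule exI[of _ "B (v $ i)"])
         (auto simp: slice_form_def coord_plane_def)
  qed
  then show ?thesis
    using represents_vec_nth(2)[OF assms] by (auto simp: SAff_def)
qed

lemma linear_eq_sum_axis:
  fixes L :: "real ^ 'n::finite \<Rightarrow> real"
  assumes "linear L"
  shows "L x = (\<Sum>j\<in>UNIV. L (axis j 1) * x $ j)"
proof -
  have "L x = L (\<Sum>j\<in>UNIV. x $ j *\<^sub>R axis j 1)"
    using basis_expansion[of x] by (simp only: scalar_mult_eq_scaleR)
  also have "\<dots> = (\<Sum>j\<in>UNIV. L (axis j 1) * x $ j)"
    using assms by (simp add: linear_sum linear_scale mult.commute)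
  finally show ?thesis .
qed

lemma Aff_subset_SAff: "Aff \<subseteq> (SAff i :: (real ^ 'n::finite \<Rightarrow> real) set)"
proof
  fix f :: "real ^ 'n \<Rightarrow> real" assume "f \<in> Aff"
  then obtain L c where f: "f \<in> L2_cube" "linear L" "AE x in lebesgue_on cube. f x = L x + c"
    by (auto simp: Aff_def)
  have "affine_on_planes i (\<lambda>x. L x + c)"
    unfolding affine_on_planes_def
  proof
    fix v :: "real ^ 'n"
    show "\<exists>a b. \<forall>x\<in>cube \<inter> (+) v ` coord_plane i. L x + c = b + (\<Sum>j\<in>UNIV - {i}. a j * x $ j)"
    proof (rule exI[of _ "\<lambda>j. L (axis j 1)"], rule exI[of _ "L (axis i 1) * v $ i + c"], rule ballI)
      fix x assume "x \<in> cube \<inter> (+) v ` coord_plane i"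
      then have "x $ i = v $ i" by (auto simp: coord_plane_def)
      moreover have "(\<Sum>j\<in>UNIV. L (axis j 1) * x $ j) =
          L (axis i 1) * x $ i + (\<Sum>j\<in>UNIV - {i}. L (axis j 1) * x $ j)"
        by (rule sum.remove) auto
      ultimately show "L x + c = L (axis i 1) * v $ i + c + (\<Sum>j\<in>UNIV - {i}. L (axis j 1) * x $ j)"
        using linear_eq_sum_axis[OF f(2), of x] by simp
    qed
  qed
  then show "f \<in> SAff i" using f by (auto simp: SAff_def)
qed

lemma affine_proj_in_Aff:
  fixes G :: "('n::finite \<Rightarrow> real) \<Rightarrow> real"
  shows "(\<lambda>x. affine_proj G (vec_nth x)) \<in> Aff"
proof -
  let ?L = "\<lambda>x. \<Sum>j\<in>UNIV. 3 * integral\<^sup>L prod_unif (\<lambda>z. G z * z j) * x $ j"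
  have "linear (\<lambda>x::real ^ 'n. \<Sum>j\<in>UNIV. c j * x $ j)" for c :: "'n \<Rightarrow> real"
    by (rule linearI) (simp_all add: distrib_left sum.distrib sum_distrib_left mult.left_commute)
  then have "linear ?L" .
  then have "\<exists>L c. linear L \<and> (AE x in lebesgue_on cube. affine_proj G (vec_nth x) = L x + c)"
    unfolding affine_proj_def by (intro exI[of _ ?L] exI[of _ "integral\<^sup>L prod_unif G"]) simp
  then show ?thesis
    unfolding Aff_def using represents_vec_nth(2)[OF sq_int_affine_proj] by blast
qed

lemma Aff_represents_affine:
  assumes f: "f \<in> Aff" and F: "represents f F"
  obtains \<beta> \<alpha> where "AE z in prod_unif. F z = \<beta> + (\<Sum>j\<in>UNIV. \<alpha> j * z j)"
proof -
  obtain L c where L: "linear L" "AE x in lebesgue_on cube. f x = L x + c"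
    using f by (auto simp: Aff_def)
  have "AE x in lebesgue_on cube. F (vec_nth x) = c + (\<Sum>j\<in>UNIV. L (axis j 1) * x $ j)"
    using L(2) conjunct2[OF F[unfolded represents_def]]
  proof eventually_elim
    case (elim x)
    then show ?case using linear_eq_sum_axis[OF L(1), of x] by simp
  qed
  from AE_cube_imp_AE_prod_unif[OF this]
  have "AE z in prod_unif. F z = c + (\<Sum>j\<in>UNIV. L (axis j 1) * z j)"
    by (simp add: vec_lambda_inverse)
  then show thesis by (rule that)
qed

lemma nearest_affine_proj:
  fixes g :: "real ^ 'n::finite \<Rightarrow> real"
  assumes g: "g \<in> L2_cube" "represents g G"
  shows "nearest Aff g (\<lambda>x. affine_proj G (vec_nth x))"
proof (rule nearest_represents[OF g _ sq_int_affine_proj affine_proj_in_Aff])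
  show "Aff \<subseteq> (L2_cube :: (real ^ 'n \<Rightarrow> real) set)" by (auto simp: Aff_def)
  have G: "sq_int prod_unif G" using g(2) by (simp add: represents_def)
  fix f :: "real ^ 'n \<Rightarrow> real" and F assume f: "f \<in> Aff" "represents f F"
  then obtain \<beta> \<alpha> where F: "AE z in prod_unif. F z = \<beta> + (\<Sum>j\<in>UNIV. \<alpha> j * z j)"
    by (rule Aff_represents_affine)
  have F_sq: "sq_int prod_unif F" using f(2) by (simp add: represents_def)
  have "integral\<^sup>L prod_unif (\<lambda>z. (G z - F z)\<^sup>2) =
      integral\<^sup>L prod_unif (\<lambda>z. (G z - (\<beta> + (\<Sum>j\<in>UNIV. \<alpha> j * z j)))\<^sup>2)"
  proof (rule integral_cong_AE)
    show "(\<lambda>z. (G z - F z)\<^sup>2) \<in> borel_measurable prod_unif"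
      by (intro borel_measurable_power sq_int_measurable sq_int_diff G F_sq)
    show "(\<lambda>z. (G z - (\<beta> + (\<Sum>j\<in>UNIV. \<alpha> j * z j)))\<^sup>2) \<in> borel_measurable prod_unif"
      by (intro borel_measurable_power sq_int_measurable[OF sq_int_diff[OF G sq_int_affine]])
    show "AE z in prod_unif. (G z - F z)\<^sup>2 = (G z - (\<beta> + (\<Sum>j\<in>UNIV. \<alpha> j * z j)))\<^sup>2"
      using F by eventually_elim simp
  qed
  with affine_proj_minimal[OF G, of \<beta> \<alpha>]
  show "integral\<^sup>L prod_unif (\<lambda>z. (G z - affine_proj G z)\<^sup>2) \<le> integral\<^sup>L prod_unif (\<lambda>z. (G z - F z)\<^sup>2)"
    by (simp only:)
qed

lemma nearest_slice_proj:
  fixes g :: "real ^ 'n::finite \<Rightarrow> real"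
  assumes g: "g \<in> L2_cube" "represents g G"
  shows "nearest (SAff i) g (\<lambda>x. slice_proj i G (vec_nth x))"
proof -
  have G: "sq_int prod_unif G" using g(2) by (simp add: represents_def)
  have P: "(\<lambda>x. slice_proj i G (vec_nth x)) \<in> SAff i"
    using sq_int_slice_proj[OF G, of i] unfolding slice_proj_def by (rule slice_form_in_SAff)
  have "SAff i \<subseteq> (L2_cube :: (real ^ 'n \<Rightarrow> real) set)" by (auto simp: SAff_def)
  then show ?thesis
  proof (rule nearest_represents[OF g _ sq_int_slice_proj[OF G] P])
    fix f :: "real ^ 'n \<Rightarrow> real" and F assume f: "f \<in> SAff i" "represents f F"
    show "integral\<^sup>L prod_unif (\<lambda>z. (G z - slice_proj i G z)\<^sup>2) \<le> integral\<^sup>L prod_unif (\<lambda>z. (G z - F z)\<^sup>2)"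
      using slice_proj_minimal[OF G _ SAff_represents_slice_affine[OF f]] f(2)
      by (simp add: represents_def)
  qed
qed

lemma nearest_le:
  assumes "nearest S g l" "f \<in> S"
  shows "L2_norm (\<lambda>x. g x - l x) \<le> L2_norm (\<lambda>x. g x - f x)"
  using assms unfolding nearest_def is_arg_min_def by (meson not_less)

lemma L2_norm_nonneg: "0 \<le> L2_norm f"
  by (simp add: L2_norm_def)

lemma L2_norm_affine_proj_le:
  fixes g :: "real ^ 'n::finite \<Rightarrow> real"
  assumes g: "g \<in> L2_cube" "represents g G" and card: "CARD('n) \<ge> 3"
  shows "L2_norm (\<lambda>x. g x - affine_proj G (vec_nth x))
    \<le> 6 * (\<Sum>i\<in>UNIV. L2_norm (\<lambda>x. g x - slice_proj i G (vec_nth x)))"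
proof -
  have G: "sq_int prod_unif G" using g(2) by (simp add: represents_def)
  define N where "N = (2 :: real) ^ CARD('n)"
  define e where "e = integral\<^sup>L prod_unif (\<lambda>z. (G z - affine_proj G z)\<^sup>2)"
  define s where "s i = integral\<^sup>L prod_unif (\<lambda>z. (G z - slice_proj i G z)\<^sup>2)" for i
  define d where "d i = L2_norm (\<lambda>x. g x - slice_proj i G (vec_nth x))" for i
  have N: "0 \<le> N" by (simp add: N_def)
  have s: "0 \<le> s i" for i by (simp add: s_def)
  have d: "d i = sqrt (N * s i)" for i
    unfolding d_def s_def N_def
    by (rule L2_norm_represents[OF g represents_vec_nth(2,1)[OF sq_int_slice_proj[OF G]]])
  have "L2_norm (\<lambda>x. g x - affine_proj G (vec_nth x)) = sqrt (N * e)"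
    unfolding e_def N_def
    by (rule L2_norm_represents[OF g represents_vec_nth(2,1)[OF sq_int_affine_proj]])
  also have "\<dots> \<le> sqrt (6\<^sup>2 * (\<Sum>i\<in>UNIV. (d i)\<^sup>2))"
  proof (rule real_sqrt_le_mono)
    have "N * e \<le> N * (36 * (\<Sum>i\<in>UNIV. s i))"
      using affine_distance_le[OF G card] N unfolding e_def s_def by (rule mult_left_mono)
    also have "\<dots> = 6\<^sup>2 * (\<Sum>i\<in>UNIV. (d i)\<^sup>2)"
      using N s by (simp add: d sum_distrib_left mult.left_commute)
    finally show "N * e \<le> 6\<^sup>2 * (\<Sum>i\<in>UNIV. (d i)\<^sup>2)" .
  qed
  also have "\<dots> = 6 * L2_set d UNIV"
    by (simp add: real_sqrt_mult L2_set_def)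
  also have "\<dots> \<le> 6 * (\<Sum>i\<in>UNIV. d i)"
    using L2_set_le_sum[of UNIV d] by (simp add: d_def L2_norm_nonneg)
  finally show ?thesis unfolding d_def .
qed

theorem proposition6p1:
  assumes "CARD('n::finite) \<ge> 3"
  shows "\<exists>C\<ge>1. \<forall>g \<in> (L2_cube :: (real ^ 'n \<Rightarrow> real) set).
    \<exists>l m. nearest Aff g l \<and> (\<forall>i. nearest (SAff i) g (m i)) \<and>
      inverse C * (\<Sum>i\<in>UNIV. L2_norm (\<lambda>x. g x - m i x)) \<le> L2_norm (\<lambda>x. g x - l x) \<and>
      L2_norm (\<lambda>x. g x - l x) \<le> C * (\<Sum>i\<in>UNIV. L2_norm (\<lambda>x. g x - m i x))"
proof -
\<comment> \<open>The lower bound needs \<open>C \<ge> d\<close> and the upper bound \<open>C \<ge> 6\<close>.\<close>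
  define C :: real where "C = 6 * CARD('n)"
  have C: "1 \<le> C" "6 \<le> C" "CARD('n) \<le> C" using assms by (simp_all add: C_def)
  have "\<exists>l m. nearest Aff g l \<and> (\<forall>i. nearest (SAff i) g (m i)) \<and>
      inverse C * (\<Sum>i\<in>UNIV. L2_norm (\<lambda>x. g x - m i x)) \<le> L2_norm (\<lambda>x. g x - l x) \<and>
      L2_norm (\<lambda>x. g x - l x) \<le> C * (\<Sum>i\<in>UNIV. L2_norm (\<lambda>x. g x - m i x))"
    if g: "g \<in> L2_cube" for g :: "real ^ 'n \<Rightarrow> real"
  proof -
    obtain G where G: "represents g G"
      using L2_cube_represents[OF g] .
    let ?l = "\<lambda>x. affine_proj G (vec_nth x)" and ?m = "\<lambda>i x. slice_proj i G (vec_nth x)"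
    define S where "S = (\<Sum>i\<in>UNIV. L2_norm (\<lambda>x. g x - ?m i x))"
    define e where "e = L2_norm (\<lambda>x. g x - ?l x)"
    have nonneg: "0 \<le> S" "0 \<le> e"
      by (auto simp: S_def e_def L2_norm_nonneg intro!: sum_nonneg)
    have "L2_norm (\<lambda>x. g x - ?m i x) \<le> e" for i
      unfolding e_def by (rule nearest_le[OF nearest_slice_proj[OF g G]])
        (rule subsetD[OF Aff_subset_SAff affine_proj_in_Aff])
    then have "S \<le> CARD('n) * e"
      unfolding S_def by (rule sum_bounded_above)
    also have "\<dots> \<le> C * e"
      by (rule mult_right_mono[OF C(3) nonneg(2)])
    finally have lower: "inverse C * S \<le> e"
      using C(1) by (simp add: inverse_eq_divide divide_le_eq mult.commute)
    have "e \<le> 6 * S"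
      unfolding e_def S_def by (rule L2_norm_affine_proj_le[OF g G assms])
    also have "\<dots> \<le> C * S"
      by (rule mult_right_mono[OF C(2) nonneg(1)])
    finally have upper: "e \<le> C * S" .
    show ?thesis
      using lower upper unfolding e_def S_def
      by (intro exI[of _ ?l] exI[of _ ?m] conjI allI nearest_affine_proj nearest_slice_proj g G)
  qed
  with C(1) show ?thesis
    by (intro exI[of _ C] conjI ballI)
qed

end
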